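(* Let $G$ be a graph with chromatic number $\chi(G)=p$, and let $H$ be a subgraph of the complement graph $\overline{G}$ with chromatic number $\chi(H)=q$. For every integer $k\geq \max\{p,q\}$ it holds that $$m(G,H,k)\leq \frac{2|E(H)|}{pq}\left[\frac{(p-r)(q-s)}{s}+\frac{r(q-s-1)}{s+1}\right],$$ where $s=\left\lfloor \frac{k}{p}\right\rfloor$ and $r=k-ps$. Moreover, the bound is tight.
   Context: Graphs are unweighted and simple. For a graph $G$, a subgraph $H$ of its complement $\overline{G}$, and a positive integer $k\geq\chi(G)$, $m(G,H,k)$ denotes the minimum, over all proper $k$-colorings of the vertices of $G$ (assignments of at most $k$ colors so that no edge of $G$ has both endpoints of the same color), of the number of monochromatic edges of $H$ (edges of $H$ whose two endpoints receive the same color) in the induced coloring. It is assumed throughout that $k<\min\{|V(G)|,\chi(G)\chi(H)\}$, since otherwise $m(G,H,k)=0$. *)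

theory Defs
  imports Complex_Main
begin

record 'a graph =
  verts :: "'a set"
  edges :: "'a set set"

definition vertex_pairs :: "'a set \<Rightarrow> 'a set set" where
  "vertex_pairs V = {e. e \<subseteq> V \<and> card e = 2}"

definition simple_graph :: "'a graph \<Rightarrow> bool" where
  "simple_graph G \<longleftrightarrow> finite (verts G) \<and> edges G \<subseteq> vertex_pairs (verts G)"

definition complement :: "'a graph \<Rightarrow> 'a graph" where
  "complement G = \<lparr>verts = verts G, edges = vertex_pairs (verts G) - edges G\<rparr>"

definition subgraph :: "'a graph \<Rightarrow> 'a graph \<Rightarrow> bool" where
  "subgraph H K \<longleftrightarrow>
     simple_graph H \<and> simple_graph K \<and> verts H \<subseteq> verts K \<and> edges H \<subseteq> edges K"

definition monochromatic :: "('a \<Rightarrow> nat) \<Rightarrow> 'a set \<Rightarrow> bool" where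
  "monochromatic c e \<longleftrightarrow> (\<forall>u\<in>e. \<forall>v\<in>e. c u = c v)"

text \<open>Colors are drawn from \<open>{..<k}\<close>; not all of them need be used. The values of a
  coloring outside the vertex set are irrelevant.\<close>

definition proper_coloring :: "'a graph \<Rightarrow> nat \<Rightarrow> ('a \<Rightarrow> nat) \<Rightarrow> bool" where
  "proper_coloring G k c \<longleftrightarrow>
     c ` verts G \<subseteq> {..<k} \<and> (\<forall>e\<in>edges G. \<not> monochromatic c e)"

definition chromatic_number :: "'a graph \<Rightarrow> nat" where
  "chromatic_number G = (LEAST k. \<exists>c. proper_coloring G k c)"

text \<open>For finite \<open>H\<close> and \<open>k \<ge> chromatic_number G\<close> the set below is finite and
  nonempty, so \<open>Min\<close> is a genuine minimum.\<close>

definition min_mono :: "'a graph \<Rightarrow> 'a graph \<Rightarrow> nat \<Rightarrow> nat" where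
  "min_mono G H k =
     Min {card {e \<in> edges H. monochromatic c e} | c. proper_coloring G k c}"

text \<open>The natural-number subtraction in \<open>r\<close> does not truncate, as \<open>p * (k div p) \<le> k\<close>;
  all other subtractions are in the reals.\<close>

definition mono_bound :: "nat \<Rightarrow> nat \<Rightarrow> nat \<Rightarrow> nat \<Rightarrow> real" where
  "mono_bound m p q k =
     (let s = k div p; r = k - p * s in
        2 * real m / (real p * real q) *
          ((real p - real r) * (real q - real s) / real s
           + real r * (real q - real s - 1) / (real s + 1)))"

end

theory Submission
  imports Defs
begin

text \<open>Merging the two color classes of \<open>H\<close> joined by the fewest edges turns \<open>t + 1\<close> colors
  into \<open>t\<close> at the price of at most a fraction \<open>2 / (t (t + 1))\<close> of the edges. Starting from a
  proper \<open>q\<close>-coloring of \<open>H\<close> the costs telescope, so \<open>t\<close> colors leave at most a fraction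
  \<open>2 / t - 2 / q = 2 (q - t) / (q t)\<close> of the edges monochromatic. Do this separately inside each
  of the \<open>p\<close> color classes of \<open>G\<close>, giving \<open>s + 1\<close> new colors to \<open>r\<close> of them and \<open>s\<close> to the
  others; averaging over the cyclic choices of the \<open>r\<close> favoured classes yields the bound.
  For \<open>p\<close> disjoint copies of \<open>K\<^sub>q\<close>, with \<open>G\<close> the complement and \<open>k = p q - 1\<close>, the bound is \<open>1\<close>,
  and the pigeonhole principle forces one monochromatic edge.\<close>

section \<open>Averaging and two-element sets\<close>

lemma exists_le_average:
  fixes f :: "'b \<Rightarrow> real"
  assumes "finite A" "A \<noteq> {}" "sum f A \<le> B"
  shows "\<exists>x\<in>A. f x \<le> B / card A"
proof (rule ccontr)
  assume "\<not> ?thesis"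
  then have "(\<Sum>x\<in>A. B / card A) < sum f A"
    using assms by (intro sum_strict_mono) auto
  then show False using assms by simp
qed

lemma card_vertex_pairs:
  assumes "finite V"
  shows "real (card (vertex_pairs V)) = real (card V) * (real (card V) - 1) / 2"
proof -
  have "card (vertex_pairs V) = card V choose 2"
    unfolding vertex_pairs_def using n_subsets[OF assms] by simp
  then show ?thesis
    by (cases "card V") (simp_all add: choose_two real_of_nat_div algebra_simps)
qed

lemma finite_vertex_pairs: "finite V \<Longrightarrow> finite (vertex_pairs V)"
  unfolding vertex_pairs_def by (rule finite_subset[of _ "Pow V"]) auto

lemma pair_in_vertex_pairs [simp]: "{u, v} \<in> vertex_pairs V \<longleftrightarrow> u \<noteq> v \<and> u \<in> V \<and> v \<in> V"
  unfolding vertex_pairs_def by auto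

lemma vertex_pairsE:
  assumes "e \<in> vertex_pairs V"
  obtains u v where "e = {u, v}" "u \<noteq> v" "u \<in> V" "v \<in> V"
  using assms unfolding vertex_pairs_def by (auto simp: card_2_iff)

lemma monochromatic_pair [simp]: "monochromatic c {u, v} \<longleftrightarrow> c u = c v"
  unfolding monochromatic_def by auto

section \<open>Recoloring a graph with fewer colors\<close>

text \<open>The image of an edge under \<open>d\<close> is at most one of the
  \<open>t * (t + 1) / 2\<close> pairs of colors, so some pair carries at most the average share of
  \<open>F\<close>. Identifying its two colors makes no other edge newly monochromatic.\<close>

lemma merge_color_classes:
  fixes d :: "'a \<Rightarrow> nat"
  assumes F: "finite F" "\<forall>e\<in>F. card e = 2" and d: "range d \<subseteq> {..<Suc t}" and t: "0 < t"
  shows "\<exists>d'. range d' \<subseteq> {..<t} \<and>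
    real (card {e \<in> F. monochromatic d' e})
      \<le> real (card {e \<in> F. monochromatic d e}) + 2 / (real t * (real t + 1)) * card F"
proof -
  let ?P = "vertex_pairs {..<Suc t}"
  have finP: "finite ?P" by (simp add: finite_vertex_pairs)
  have cP: "real (card ?P) = real t * (real t + 1) / 2"
    by (simp add: card_vertex_pairs)
  have "card ?P \<noteq> 0" using cP t by (intro notI) simp
  then have neP: "?P \<noteq> {}" by auto
  have "(\<Sum>P\<in>?P. card {e \<in> F. d ` e = P}) = card (\<Union>P\<in>?P. {e \<in> F. d ` e = P})"
    using F finP by (subst card_UN_disjoint) auto
  also have "\<dots> \<le> card F" using F by (intro card_mono) auto
  finally have "(\<Sum>P\<in>?P. real (card {e \<in> F. d ` e = P})) \<le> real (card F)"
    by (simp flip: of_nat_sum)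
  from exists_le_average[OF finP neP this] obtain P where
    P: "P \<in> ?P" and le: "real (card {e \<in> F. d ` e = P}) \<le> card F / card ?P" by blast
  obtain a b where ab: "P = {a, b}" "a \<noteq> b"
    using P unfolding vertex_pairs_def by (auto simp: card_2_iff)
  define x y where "x = min a b" and "y = max a b"
  have xy: "P = {x, y}" "x < y" "y \<le> t"
    using ab P unfolding x_def y_def vertex_pairs_def by (auto simp: min_def max_def)
  \<comment> \<open>Color \<open>y\<close> is absorbed into \<open>x\<close>, and the top color
    \<open>t\<close> takes over the freed name \<open>y\<close>, so only colors below
    \<open>t\<close> remain. The order \<open>x < y \<le> t\<close> ensures \<open>x < t\<close>; if
    \<open>y = t\<close>, the first case takes precedence.\<close>
  define d' where "d' v = (if d v = y then x else if d v = t then y else d v)" for v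
  have "d' v < t" for v
    using xy d[unfolded image_subset_iff, rule_format, of v] by (auto simp: d'_def)
  then have r: "range d' \<subseteq> {..<t}" by auto
  have "{e \<in> F. monochromatic d' e} \<subseteq> {e \<in> F. monochromatic d e} \<union> {e \<in> F. d ` e = P}"
  proof
    fix e assume e: "e \<in> {e \<in> F. monochromatic d' e}"
    then obtain u v where uv: "e = {u, v}" using F by (auto simp: card_2_iff)
    with e have "d' u = d' v" by simp
    then have "d u = d v \<or> {d u, d v} = P"
      using xy by (auto simp: d'_def split: if_splits)
    with e uv show "e \<in> {e \<in> F. monochromatic d e} \<union> {e \<in> F. d ` e = P}" by auto
  qed
  then have "card {e \<in> F. monochromatic d' e}
      \<le> card ({e \<in> F. monochromatic d e} \<union> {e \<in> F. d ` e = P})"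
    using F by (intro card_mono) auto
  also have "\<dots> \<le> card {e \<in> F. monochromatic d e} + card {e \<in> F. d ` e = P}"
    by (rule card_Un_le)
  finally have "real (card {e \<in> F. monochromatic d' e})
      \<le> real (card {e \<in> F. monochromatic d e}) + real (card {e \<in> F. d ` e = P})"
    by linarith
  with le r show ?thesis unfolding cP by (intro exI[of _ d']) (auto simp: mult.commute)
qed

text \<open>Downward induction from \<open>q\<close> colors, where \<open>d\<close> leaves no edge
  monochromatic. Passing from \<open>t + 1\<close> to \<open>t\<close> colors costs at most the
  fraction \<open>2 / t - 2 / (t + 1)\<close> of the edges, and these costs telescope.\<close>

lemma coloring_with_few_monochromatic:
  fixes d :: "'a \<Rightarrow> nat"
  assumes F: "finite F" "\<forall>e\<in>F. card e = 2"
    and d: "range d \<subseteq> {..<q}" "\<forall>e\<in>F. \<not> monochromatic d e" and t: "0 < t" "t \<le> q"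
  shows "\<exists>d'. range d' \<subseteq> {..<t} \<and>
    real (card {e \<in> F. monochromatic d' e}) \<le> (2 / real t - 2 / real q) * card F"
  using t(2,1)
proof (induction t rule: inc_induct)
  case base
  have none: "{e \<in> F. monochromatic d e} = {}" using d by auto
  show ?case using d(1) by (intro exI[of _ d]) (simp add: none del: Collect_empty_eq)
next
  case (step t)
  then obtain d1 where d1: "range d1 \<subseteq> {..<Suc t}"
    "real (card {e \<in> F. monochromatic d1 e}) \<le> (2 / real (Suc t) - 2 / real q) * card F" by blast
  from merge_color_classes[OF F d1(1) step.prems] obtain d2 where d2: "range d2 \<subseteq> {..<t}"
    "real (card {e \<in> F. monochromatic d2 e})
      \<le> real (card {e \<in> F. monochromatic d1 e}) + 2 / (real t * (real t + 1)) * card F" by blast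
  have "2 / real t - 2 / real q = (2 / real (Suc t) - 2 / real q) + 2 / (real t * (real t + 1))"
    using step.prems by (simp add: divide_simps) (simp add: algebra_simps)
  then have "(2 / real t - 2 / real q) * card F
      = (2 / real (Suc t) - 2 / real q) * card F + 2 / (real t * (real t + 1)) * card F"
    by (simp only: distrib_right)
  with d1 d2 show ?case by (intro exI[of _ d2]) auto
qed

section \<open>Attainment of the chromatic number and of the minimum\<close>

lemma proper_coloring_chromatic_number:
  assumes "simple_graph G"
  shows "\<exists>c. proper_coloring G (chromatic_number G) c"
proof -
  have "finite (verts G)" using assms by (simp add: simple_graph_def)
  \<comment> \<open>An injective numbering of the vertices is a proper coloring, so
    \<open>LEAST\<close> ranges over a nonempty set.\<close>
  from finite_imp_inj_to_nat_seg[OF this] obtain c :: "'a \<Rightarrow> nat" and n where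
    c: "c ` verts G = {i. i < n}" "inj_on c (verts G)" by blast
  have "\<not> monochromatic c e" if "e \<in> edges G" for e
  proof -
    have "e \<subseteq> verts G" "card e = 2"
      using that assms by (auto simp: simple_graph_def vertex_pairs_def)
    then show ?thesis using c(2) by (auto simp: card_2_iff inj_on_def)
  qed
  then have "proper_coloring G n c" using c by (auto simp: proper_coloring_def)
  then have "\<exists>k c. proper_coloring G k c" by blast
  then show ?thesis unfolding chromatic_number_def by (rule LeastI_ex)
qed

lemma
  assumes "simple_graph H" "proper_coloring G k c"
  shows min_mono_attained:
      "\<exists>c. proper_coloring G k c \<and> min_mono G H k = card {e \<in> edges H. monochromatic c e}"
    and min_mono_le: "min_mono G H k \<le> card {e \<in> edges H. monochromatic c e}"
proof -
  let ?S = "{card {e \<in> edges H. monochromatic c e} | c. proper_coloring G k c}"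
  have "finite (edges H)"
    using assms(1) finite_vertex_pairs finite_subset by (fastforce simp: simple_graph_def)
  \<comment> \<open>There may be infinitely many colorings, since values outside the vertex set are
    free, but the counts are bounded by the number of edges.\<close>
  then have "?S \<subseteq> {..card (edges H)}" by (auto intro!: card_mono)
  then have fin: "finite ?S" by (rule finite_subset) simp
  have ne: "?S \<noteq> {}" using assms(2) by auto
  show "\<exists>c. proper_coloring G k c \<and> min_mono G H k = card {e \<in> edges H. monochromatic c e}"
    using Min_in[OF fin ne] unfolding min_mono_def by auto
  show "min_mono G H k \<le> card {e \<in> edges H. monochromatic c e}"
    unfolding min_mono_def using fin assms(2) by (intro Min_le) auto
qed

section \<open>Splitting the color classes of G\<close>

text \<open>Class \<open>i\<close> of \<open>c\<close> receives its own palette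
  \<open>i + p * x\<close> with \<open>x < t i\<close>. The palettes are disjoint and lie below
  \<open>k\<close>, so the refined coloring stays proper for \<open>G\<close>, and edges of
  \<open>H\<close> between different classes cost nothing. Inside each class the recoloring of
  \<open>H\<close> with few colors applies.\<close>

lemma min_mono_le_split_classes:
  assumes G: "simple_graph G" and H: "simple_graph H" "verts H \<subseteq> verts G"
    and c: "proper_coloring G p c" and d: "proper_coloring H q d"
    and t: "\<And>i. i < p \<Longrightarrow> 0 < t i \<and> t i \<le> q"
    and tk: "\<And>i x. i < p \<Longrightarrow> x < t i \<Longrightarrow> i + p * x < k"
  shows "real (min_mono G H k)
    \<le> (\<Sum>i<p. (2 / real (t i) - 2 / real q) * card {e \<in> edges H. c ` e = {i}})"
proof -
  have finE: "finite (edges H)" and E: "\<And>e. e \<in> edges H \<Longrightarrow> e \<subseteq> verts H \<and> card e = 2"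
    using H(1) finite_vertex_pairs finite_subset
    by (fastforce simp: simple_graph_def vertex_pairs_def)+
  define F where "F i = {e \<in> edges H. c ` e = {i}}" for i
  \<comment> \<open>A proper coloring is constrained only on the vertices, while the recoloring
    lemma bounds the whole range. The default \<open>0\<close> is below \<open>q\<close> because
    \<open>0 < t i \<le> q\<close>.\<close>
  define d0 where "d0 v = (if v \<in> verts H then d v else 0)" for v
  have "\<exists>D. range D \<subseteq> {..<t i} \<and> real (card {e \<in> F i. monochromatic D e})
      \<le> (2 / real (t i) - 2 / real q) * card (F i)" if i: "i < p" for i
  proof (rule coloring_with_few_monochromatic)
    show "finite (F i)" "\<forall>e\<in>F i. card e = 2" using finE E by (auto simp: F_def)
    show "range d0 \<subseteq> {..<q}"
      using d t[OF i] by (auto simp: d0_def proper_coloring_def)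
    show "\<forall>e\<in>F i. \<not> monochromatic d0 e"
    proof
      fix e assume "e \<in> F i"
      then have e: "e \<in> edges H" "e \<subseteq> verts H" using E by (auto simp: F_def)
      then have "monochromatic d0 e \<longleftrightarrow> monochromatic d e"
        unfolding monochromatic_def d0_def by (auto simp: subset_iff)
      then show "\<not> monochromatic d0 e" using d e by (simp add: proper_coloring_def)
    qed
  qed (use t[OF i] in auto)
  then obtain D where D: "\<And>i. i < p \<Longrightarrow> range (D i) \<subseteq> {..<t i}"
    "\<And>i. i < p \<Longrightarrow> real (card {e \<in> F i. monochromatic (D i) e})
      \<le> (2 / real (t i) - 2 / real q) * card (F i)" by metis
  \<comment> \<open>This encodes the pair of the old class and the new color inside it; the residue
    modulo \<open>p\<close> recovers the class.\<close>
  define g where "g v = c v + p * D (c v) v" for v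
  have cp: "c v < p" if "v \<in> verts G" for v
    using c that by (auto simp: proper_coloring_def)
  have gmod: "g v mod p = c v" if "v \<in> verts G" for v
    using cp[OF that] by (simp add: g_def)
  have geq: "c u = c v \<and> D (c u) u = D (c u) v"
    if "u \<in> verts G" "v \<in> verts G" "g u = g v" for u v
  proof -
    have "c u = c v" using that gmod by metis
    with that cp show ?thesis by (auto simp: g_def)
  qed
  have "\<not> monochromatic g e" if e: "e \<in> edges G" for e
  proof -
    have "\<not> monochromatic c e" using c e by (simp add: proper_coloring_def)
    moreover have "e \<subseteq> verts G" using G e by (auto simp: simple_graph_def vertex_pairs_def)
    ultimately show ?thesis using geq unfolding monochromatic_def by blast
  qed
  moreover have "g v < k" if "v \<in> verts G" for v
    unfolding g_def using D(1)[OF cp[OF that]] by (intro tk cp that) auto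
  ultimately have "proper_coloring G k g" by (auto simp: proper_coloring_def)
  then have min_le: "min_mono G H k \<le> card {e \<in> edges H. monochromatic g e}"
    by (rule min_mono_le[OF H(1)])
  have "{e \<in> edges H. monochromatic g e} \<subseteq> (\<Union>i<p. {e \<in> F i. monochromatic (D i) e})"
  proof
    fix e assume "e \<in> {e \<in> edges H. monochromatic g e}"
    then have e: "e \<in> edges H" "monochromatic g e" by auto
    then obtain u v where uv: "e = {u, v}" using E[OF e(1)] by (auto simp: card_2_iff)
    then have V: "u \<in> verts G" "v \<in> verts G" using E[OF e(1)] H(2) by auto
    have "c u = c v \<and> D (c u) u = D (c u) v" using e uv by (intro geq V) simp
    then have "e \<in> {e \<in> F (c u). monochromatic (D (c u)) e}"
      using e uv by (auto simp: F_def)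
    then show "e \<in> (\<Union>i<p. {e \<in> F i. monochromatic (D i) e})" using cp V by blast
  qed
  then have "card {e \<in> edges H. monochromatic g e}
      \<le> card (\<Union>i<p. {e \<in> F i. monochromatic (D i) e})"
    using finE by (intro card_mono) (auto simp: F_def)
  also have "\<dots> \<le> (\<Sum>i<p. card {e \<in> F i. monochromatic (D i) e})"
    by (rule card_UN_le) simp
  finally have "real (min_mono G H k) \<le> (\<Sum>i<p. real (card {e \<in> F i. monochromatic (D i) e}))"
    using min_le by (simp flip: of_nat_sum)
  also have "\<dots> \<le> (\<Sum>i<p. (2 / real (t i) - 2 / real q) * card (F i))"
    using D(2) by (intro sum_mono) auto
  finally show ?thesis by (simp add: F_def)
qed

section \<open>Cyclic shifts and the averaged upper bound\<close>

lemma bij_betw_shift_mod: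
  assumes "0 < (p::nat)"
  shows "bij_betw (\<lambda>j. (i + j) mod p) {..<p} {..<p}"
proof -
  have "inj_on (\<lambda>j. (i + j) mod p) {..<p}"
  proof (rule inj_onI)
    fix x y assume xy: "x \<in> {..<p}" "y \<in> {..<p}" "(i + x) mod p = (i + y) mod p"
    then have "int p dvd int (i + x) - int (i + y)"
      by (metis mod_eq_dvd_iff of_nat_mod)
    then have "int p dvd int x - int y" by simp
    then show "x = y" using xy zdvd_imp_le[of "int p" "\<bar>int x - int y\<bar>"] by fastforce
  qed
  moreover have "(\<lambda>j. (i + j) mod p) ` {..<p} \<subseteq> {..<p}" using assms by auto
  ultimately show ?thesis
    by (simp add: bij_betw_def endo_inj_surj)
qed

text \<open>Palette sizes are attached to color names, so renaming the colors cyclically changes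
  which classes get the larger palettes.\<close>

lemma proper_coloring_shift:
  assumes c: "proper_coloring G p c" and G: "simple_graph G" and p: "0 < p"
  shows "proper_coloring G p (\<lambda>v. (j + c v) mod p)"
proof -
  have inj: "c u = c v" if "u \<in> verts G" "v \<in> verts G" "(j + c u) mod p = (j + c v) mod p" for u v
  proof (rule inj_onD[OF bij_betw_imp_inj_on[OF bij_betw_shift_mod[OF p, of j]] that(3)])
    show "c u \<in> {..<p}" "c v \<in> {..<p}" using that c by (auto simp: proper_coloring_def)
  qed
  have "\<not> monochromatic (\<lambda>v. (j + c v) mod p) e" if e: "e \<in> edges G" for e
  proof -
    have "\<not> monochromatic c e" using c e by (simp add: proper_coloring_def)
    moreover have "e \<subseteq> verts G" using G e by (auto simp: simple_graph_def vertex_pairs_def)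
    ultimately show ?thesis using inj unfolding monochromatic_def by blast
  qed
  then show ?thesis using p by (auto simp: proper_coloring_def)
qed

lemma min_mono_le_mono_bound:
  assumes G: "simple_graph G" and H: "subgraph H (complement G)"
    and p: "chromatic_number G = p" and q: "chromatic_number H = q"
    and k: "p \<le> k" "k < p * q"
  shows "real (min_mono G H k) \<le> mono_bound (card (edges H)) p q k"
proof -
  have sH: "simple_graph H" and VH: "verts H \<subseteq> verts G"
    using H by (auto simp: subgraph_def complement_def)
  have finE: "finite (edges H)" and E: "\<And>e. e \<in> edges H \<Longrightarrow> e \<subseteq> verts H \<and> card e = 2"
    using sH finite_vertex_pairs finite_subset
    by (fastforce simp: simple_graph_def vertex_pairs_def)+
  have pos: "0 < p" "0 < q" using k by (auto intro: Nat.gr0I)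
  obtain c d where c: "proper_coloring G p c" and d: "proper_coloring H q d"
    using proper_coloring_chromatic_number[OF G] proper_coloring_chromatic_number[OF sH] p q by auto
  have cp: "c v < p" if "v \<in> verts G" for v
    using c that by (auto simp: proper_coloring_def)
  define s r where "s = k div p" and "r = k - p * s"
  have kr: "k = p * s + r" "r < p"
    using pos by (simp_all add: s_def r_def minus_mult_div_eq_mod)
  \<comment> \<open>Strictness in \<open>s < q\<close> matters: the larger palette size
    \<open>Suc s\<close> must also be at most \<open>q\<close>.\<close>
  have s: "0 < s" "s < q"
    using k pos by (auto simp: s_def div_greater_zero_iff less_mult_imp_div_less mult.commute)
  \<comment> \<open>The sizes add up to \<open>p * s + r = k\<close>. Only the first
    \<open>r\<close> names use the layer \<open>x = s\<close>, where \<open>i + p * s < k\<close>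
    holds exactly for \<open>i < r\<close>.\<close>
  define t where "t i = (if i < r then Suc s else s)" for i
  define f where "f i = 2 / real (t i) - 2 / real q" for i
  have tk: "i + p * x < k" if "i < p" "x < t i" for i x
  proof (cases "x < s")
    case True
    then have "p * Suc x \<le> p * s" by (intro mult_le_mono2) simp
    then show ?thesis using that kr by simp
  next
    case False
    then have "x = s" "i < r" using that by (auto simp: t_def split: if_splits)
    then show ?thesis using kr by simp
  qed
  define W where "W i = real (card {e \<in> edges H. c ` e = {i}})" for i
  have shift: "real (min_mono G H k) \<le> (\<Sum>i<p. f ((j + i) mod p) * W i)" for j
  proof -
    let ?\<pi> = "\<lambda>i. (j + i) mod p"
    note bij = bij_betw_shift_mod[OF pos(1), of j]
    have "real (min_mono G H k) \<le> (\<Sum>i<p. f i * card {e \<in> edges H. (\<lambda>v. ?\<pi> (c v)) ` e = {i}})"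
      unfolding f_def
      using s by (intro min_mono_le_split_classes[OF G sH VH proper_coloring_shift[OF c G pos(1)] d] tk)
        (auto simp: t_def)
    \<comment> \<open>Reindexing by the shift lets \<open>i\<close> name the classes of the
      unshifted \<open>c\<close>, so the edge counts become the fixed numbers \<open>W i\<close> and
      only the weights depend on \<open>j\<close>.\<close>
    also have "\<dots> = (\<Sum>i<p. f (?\<pi> i) * card {e \<in> edges H. (\<lambda>v. ?\<pi> (c v)) ` e = {?\<pi> i}})"
      by (rule sum.reindex_bij_betw[OF bij, symmetric])
    also have "\<dots> = (\<Sum>i<p. f (?\<pi> i) * W i)"
    proof (rule sum.cong)
      fix i assume i: "i \<in> {..<p}"
      have "(\<lambda>v. ?\<pi> (c v)) ` e = {?\<pi> i} \<longleftrightarrow> c ` e = {i}" if "e \<in> edges H" for e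
      proof -
        have "c ` e \<subseteq> {..<p}" using E[OF that] VH cp by auto
        then have "?\<pi> ` (c ` e) = ?\<pi> ` {i} \<longleftrightarrow> c ` e = {i}"
          using bij i by (intro inj_on_image_eq_iff[of _ "{..<p}"]) (auto simp: bij_betw_def)
        then show ?thesis by (simp add: image_image)
      qed
      then have "{e \<in> edges H. (\<lambda>v. ?\<pi> (c v)) ` e = {?\<pi> i}} = {e \<in> edges H. c ` e = {i}}"
        by blast
      then show "f (?\<pi> i) * card {e \<in> edges H. (\<lambda>v. ?\<pi> (c v)) ` e = {?\<pi> i}} = f (?\<pi> i) * W i"
        by (simp add: W_def)
    qed simp
    finally show ?thesis .
  qed
  define B where "B = (real p - real r) * (2 / real s - 2 / real q)
    + real r * (2 / real (Suc s) - 2 / real q)"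
  have sumf: "(\<Sum>i<p. f i) = B"
  proof -
    have "(\<Sum>i<p. f i) = (\<Sum>i<r. f i) + (\<Sum>i=r..<p. f i)"
      using kr by (simp add: lessThan_atLeast0 sum.atLeastLessThan_concat)
    also have "(\<Sum>i<r. f i) = real r * (2 / real (Suc s) - 2 / real q)"
      by (simp add: f_def t_def)
    also have "(\<Sum>i=r..<p. f i) = (real p - real r) * (2 / real s - 2 / real q)"
      using kr by (simp add: f_def t_def of_nat_diff)
    finally show ?thesis by (simp add: B_def)
  qed
  \<comment> \<open>The sign is needed to pass from the sum of the \<open>W i\<close>, which omits
    edges of \<open>H\<close> between classes, to all edges of \<open>H\<close>.\<close>
  have B0: "0 \<le> B"
    unfolding sumf[symmetric] using s
    by (intro sum_nonneg) (auto simp: f_def t_def field_simps)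
  have "real p * real (min_mono G H k) = (\<Sum>j<p. real (min_mono G H k))" by simp
  also have "\<dots> \<le> (\<Sum>j<p. \<Sum>i<p. f ((j + i) mod p) * W i)"
    by (intro sum_mono shift)
  \<comment> \<open>For fixed \<open>i\<close> the shifts run through all names once, so every class
    meets every weight exactly once and the inner sum is \<open>B * W i\<close>.\<close>
  also have "\<dots> = (\<Sum>i<p. \<Sum>j<p. f ((i + j) mod p) * W i)"
    by (subst sum.swap) (simp add: add.commute)
  also have "\<dots> = (\<Sum>i<p. B * W i)"
    by (simp add: sum.reindex_bij_betw[OF bij_betw_shift_mod[OF pos(1)]] sumf
        flip: sum_distrib_right)
  also have "\<dots> = B * (\<Sum>i<p. W i)" by (simp add: sum_distrib_left)
  also have "\<dots> \<le> B * card (edges H)"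
  proof (rule mult_left_mono[OF _ B0])
    have "(\<Sum>i<p. card {e \<in> edges H. c ` e = {i}}) = card (\<Union>i<p. {e \<in> edges H. c ` e = {i}})"
      using finE by (subst card_UN_disjoint) auto
    also have "\<dots> \<le> card (edges H)" using finE by (intro card_mono) auto
    finally show "(\<Sum>i<p. W i) \<le> card (edges H)" unfolding W_def by (simp flip: of_nat_sum)
  qed
  finally have "real (min_mono G H k) \<le> B * card (edges H) / real p"
    using pos by (simp add: field_simps)
  also have "\<dots> = mono_bound (card (edges H)) p q k"
  proof -
    have "2 / x - 2 / real q = 2 / real q * ((real q - x) / x)" if "0 < x" for x :: real
      using that pos by (simp add: field_simps)
    from this[of "real s"] this[of "real (Suc s)"] have
      "B = 2 / real q * ((real p - real r) * (real q - real s) / real s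
           + real r * (real q - real s - 1) / (real s + 1))"
      unfolding B_def using s by (simp add: distrib_left mult_ac diff_diff_eq add.commute)
    then show ?thesis
      by (simp add: mono_bound_def Let_def s_def[symmetric] r_def[symmetric] mult_ac)
  qed
  finally show ?thesis .
qed

section \<open>Tightness\<close>

text \<open>The coloring bounds the chromatic number from above, and the clique \<open>K\<close>
  from below, since a proper coloring is injective on it.\<close>

lemma chromatic_number_eqI:
  assumes c: "proper_coloring G n c"
    and K: "K \<subseteq> verts G" "card K = n" "vertex_pairs K \<subseteq> edges G"
  shows "chromatic_number G = n"
  unfolding chromatic_number_def
proof (rule Least_equality)
  show "\<exists>c. proper_coloring G n c" using c by blast
  fix m assume "\<exists>c. proper_coloring G m c"
  then obtain c' where c': "proper_coloring G m c'" by blast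
  have "inj_on c' K"
  proof (rule inj_onI, rule ccontr)
    fix u v assume uv: "u \<in> K" "v \<in> K" "c' u = c' v" "u \<noteq> v"
    then have "{u, v} \<in> edges G" using K by (auto simp: vertex_pairs_def)
    then show False using c' uv by (auto simp: proper_coloring_def)
  qed
  moreover have "c' ` K \<subseteq> {..<m}" using c' K by (auto simp: proper_coloring_def)
  ultimately have "card K \<le> card {..<m}" by (intro card_inj_on_le) auto
  then show "n \<le> m" using K by simp
qed

text \<open>If \<open>p\<close> or \<open>q\<close> is below \<open>2\<close>, no \<open>k\<close>
  satisfies \<open>max p q \<le> k < p * q\<close>, so every pair admitting some \<open>k\<close> is
  covered. Vertices are numbered below \<open>p * q\<close>: \<open>v mod p\<close> names the copy
  of the complete graph on \<open>q\<close> vertices and \<open>v div p\<close> the position in it.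
  Thus \<open>G\<close> is complete \<open>p\<close>-partite with parts of size
  \<open>q\<close>.\<close>

lemma mono_bound_tight:
  assumes p: "2 \<le> p" and q: "2 \<le> q"
  shows "\<exists>(G :: nat graph) H k.
    simple_graph G \<and> subgraph H (complement G) \<and>
    chromatic_number G = p \<and> chromatic_number H = q \<and>
    max p q \<le> k \<and> k < min (card (verts G)) (p * q) \<and>
    real (min_mono G H k) = mono_bound (card (edges H)) p q k"
proof -
  define V where "V = {..<p * q}"
  define EH where "EH = {e \<in> vertex_pairs V. monochromatic (\<lambda>v. v mod p) e}"
  define G :: "nat graph" where "G = \<lparr>verts = V, edges = vertex_pairs V - EH\<rparr>"
  define H :: "nat graph" where "H = \<lparr>verts = V, edges = EH\<rparr>"
  define k where "k = p * q - 1"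
  have sG: "simple_graph G" by (auto simp: simple_graph_def G_def V_def)
  have sub: "subgraph H (complement G)"
    by (auto simp: subgraph_def complement_def simple_graph_def G_def H_def V_def EH_def)
  have pq: "p * 2 \<le> p * q" "2 * q \<le> p * q" using p q by auto
  have chiG: "chromatic_number G = p"
  proof (rule chromatic_number_eqI)
    show "proper_coloring G p (\<lambda>v. v mod p)"
      using p by (auto simp: proper_coloring_def G_def EH_def)
    \<comment> \<open>The numbers below \<open>p\<close> have distinct residues: one vertex from
      each part, forming a clique of \<open>G\<close>.\<close>
    show "{..<p} \<subseteq> verts G" using pq by (auto simp: G_def V_def)
    then have "{..<p} \<subseteq> V" by (simp add: G_def)
    then show "vertex_pairs {..<p} \<subseteq> edges G"
      by (auto simp: G_def EH_def elim!: vertex_pairsE)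
  qed simp
  have part: "card {v \<in> V. v mod p = i} = q" if "i < p" for i
  proof -
    have "{v \<in> V. v mod p = i} = (\<lambda>x. i + p * x) ` {..<q}"
    proof (intro equalityI subsetI)
      fix v assume v: "v \<in> {v \<in> V. v mod p = i}"
      then have "v div p < q" by (simp add: V_def less_mult_imp_div_less mult.commute)
      moreover have "v = i + p * (v div p)" using v mod_mult_div_eq[of v p] by simp
      ultimately show "v \<in> (\<lambda>x. i + p * x) ` {..<q}" by blast
    next
      fix v assume "v \<in> (\<lambda>x. i + p * x) ` {..<q}"
      then obtain x where x: "x < q" "v = i + p * x" by auto
      have "p * Suc x \<le> p * q" using x by (intro mult_le_mono2) simp
      then show "v \<in> {v \<in> V. v mod p = i}" using x that by (simp add: V_def)
    qed
    moreover have "inj_on (\<lambda>x. i + p * x) {..<q}" using p by (auto simp: inj_on_def)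
    ultimately show ?thesis by (simp add: card_image)
  qed
  have chiH: "chromatic_number H = q"
  proof (rule chromatic_number_eqI)
    have "u = v" if "u mod p = v mod p" "u div p = v div p" for u v :: nat
      using that by (metis mod_mult_div_eq)
    then show "proper_coloring H q (\<lambda>v. v div p)"
      by (auto simp: proper_coloring_def H_def V_def EH_def less_mult_imp_div_less mult.commute
          elim!: vertex_pairsE)
    show "card {v \<in> V. v mod p = 0} = q" using p by (intro part) simp
    show "vertex_pairs {v \<in> V. v mod p = 0} \<subseteq> edges H"
      by (auto simp: H_def EH_def elim!: vertex_pairsE)
  qed (auto simp: H_def)
  have "EH = (\<Union>i<p. vertex_pairs {v \<in> V. v mod p = i})"
    using p by (auto simp: EH_def elim!: vertex_pairsE)
  also have "card \<dots> = (\<Sum>i<p. card (vertex_pairs {v \<in> V. v mod p = i}))"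
    by (intro card_UN_disjoint)
      (auto simp: V_def finite_vertex_pairs doubleton_eq_iff elim!: vertex_pairsE)
  finally have "real (card EH) = (\<Sum>i<p. real (card (vertex_pairs {v \<in> V. v mod p = i})))"
    by simp
  also have "\<dots> = (\<Sum>i<p. real q * (real q - 1) / 2)"
    using part by (intro sum.cong) (auto simp: card_vertex_pairs V_def)
  finally have cE: "real (card (edges H)) = real p * (real q * (real q - 1) / 2)"
    by (simp add: H_def)
  \<comment> \<open>Here \<open>s = q - 1\<close> and \<open>r = p - 1\<close>, so the bracket
    reduces to \<open>1 / (q - 1)\<close>, while the factor in front of it equals
    \<open>q - 1\<close>.\<close>
  have k: "k = (p - 1) + p * (q - 1)" using p q pq by (simp add: k_def diff_mult_distrib2)
  have kd: "k div p = q - 1" unfolding k using p by (subst div_mult_self2) auto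
  have kr: "k - p * (q - 1) = p - 1" unfolding k by simp
  have bound: "mono_bound (card (edges H)) p q k = 1"
    unfolding mono_bound_def Let_def kd kr cE using p q by (simp add: of_nat_diff field_simps)
  have kk: "max p q \<le> k" "k < p * q" unfolding k_def using p q pq by linarith+
  have le: "real (min_mono G H k) \<le> 1"
    using min_mono_le_mono_bound[OF sG sub chiG chiH, of k] kk bound by simp
  have "proper_coloring G k (\<lambda>v. v mod p)"
    using p kk by (auto simp: proper_coloring_def G_def EH_def intro: less_le_trans[of _ p])
  then obtain c where c: "proper_coloring G k c"
    "min_mono G H k = card {e \<in> edges H. monochromatic c e}"
    using min_mono_attained[of H G k] sub by (metis subgraph_def)
  \<comment> \<open>With fewer colors than vertices, two vertices share a color. They are
    nonadjacent in \<open>G\<close>, hence adjacent in \<open>H\<close>, so the minimum is at least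
    \<open>1\<close>.\<close>
  have "card (c ` V) \<le> card {..<k}"
    using c(1) by (intro card_mono) (auto simp: proper_coloring_def G_def)
  then have "card (c ` V) < card V" using kk by (simp add: V_def)
  then obtain u v where uv: "u \<in> V" "v \<in> V" "u \<noteq> v" "c u = c v"
    using pigeonhole[of c V] by (auto simp: inj_on_def)
  then have "{u, v} \<notin> edges G" using c(1) by (auto simp: proper_coloring_def)
  then have "{u, v} \<in> {e \<in> edges H. monochromatic c e}"
    using uv by (auto simp: G_def H_def vertex_pairs_def)
  moreover have "finite {e \<in> edges H. monochromatic c e}"
    by (simp add: H_def EH_def V_def finite_vertex_pairs)
  ultimately have "min_mono G H k \<noteq> 0" using c(2) by (metis card_0_eq empty_iff)
  with le have "real (min_mono G H k) = mono_bound (card (edges H)) p q k"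
    using bound by simp
  moreover have "k < min (card (verts G)) (p * q)" using kk by (simp add: G_def V_def)
  ultimately show ?thesis using sG sub chiG chiH kk by blast
qed

theorem theorem8:
  shows "(\<forall>(G :: 'a graph) H p q k.
            simple_graph G \<and> subgraph H (complement G) \<and>
            chromatic_number G = p \<and> chromatic_number H = q \<and>
            max p q \<le> k \<and> k < min (card (verts G)) (p * q)
            \<longrightarrow> real (min_mono G H k) \<le> mono_bound (card (edges H)) p q k)
       \<and> (\<forall>p q. 2 \<le> p \<and> 2 \<le> q \<longrightarrow>
            (\<exists>(G :: nat graph) H k.
              simple_graph G \<and> subgraph H (complement G) \<and>
              chromatic_number G = p \<and> chromatic_number H = q \<and>
              max p q \<le> k \<and> k < min (card (verts G)) (p * q) \<and>
              real (min_mono G H k) = mono_bound (card (edges H)) p q k))"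
proof (intro conjI allI impI)
  fix G H :: "'a graph" and p q k
  assume "simple_graph G \<and> subgraph H (complement G) \<and>
    chromatic_number G = p \<and> chromatic_number H = q \<and>
    max p q \<le> k \<and> k < min (card (verts G)) (p * q)"
  then show "real (min_mono G H k) \<le> mono_bound (card (edges H)) p q k"
    by (intro min_mono_le_mono_bound) auto
qed (rule mono_bound_tight, simp_all)

end
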